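(* For every integer $k\ge1$, $$E^{(k-1)(k-2)\cdots1k}_{1\text{-}23}(x)=\begin{cases}e^{e^x}\displaystyle\int_0^x\int_0^t\frac{r^{k-2}}{(k-2)!}\,e^{r-e^t}\,dr\,dt,&\text{if }k\ge2,\\[2mm] e^{e^x-1},&\text{if }k=1.\end{cases}$$
   Context: A permutation $\pi=\pi_1\cdots\pi_n$ of $\{1,\dots,n\}$ contains the generalized pattern $1\text{-}23$ if there are indices $i<j<n$ such that $\pi_i\pi_j\pi_{j+1}$ is order-isomorphic to $123$; otherwise it avoids it. A permutation $\pi$ begins with a pattern $p=p_1\cdots p_k$ if $n\ge k$ and $\pi_1\cdots\pi_k$ is order-isomorphic to $p$; by convention, the empty permutation is also regarded as beginning with the pattern $1$ (the case $k=1$). The pattern $(k-1)(k-2)\cdots1k$ consists of $k-1,k-2,\dots,1$ in decreasing order followed by $k$ (for $k=1$ it is $1$, for $k=2$ it is $12$). $E^p_q(x)=\sum_{n\ge0}N^p_q(n)\frac{x^n}{n!}$, where $N^p_q(n)$ is the number of permutations of $\{1,\dots,n\}$ that avoid $q$ and begin with $p$. Identities are identities of power series in $x$. *)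

theory Defs
  imports "HOL-Combinatorics.Multiset_Permutations" "HOL-Analysis.Analysis"
begin

definition order_isomorphic :: "nat list \<Rightarrow> nat list \<Rightarrow> bool" where
  "order_isomorphic xs ys \<longleftrightarrow> length xs = length ys \<and>
     (\<forall>i < length xs. \<forall>j < length xs. xs ! i < xs ! j \<longleftrightarrow> ys ! i < ys ! j)"

text \<open>Permutations of \<open>{1..n}\<close> are words, i.e. elements of \<open>permutations_of_set {1..n}\<close>;
  their positions are counted from 0.\<close>

definition contains_1_23 :: "nat list \<Rightarrow> bool" where
  "contains_1_23 w \<longleftrightarrow>
     (\<exists>i j. i < j \<and> j + 1 < length w \<and> order_isomorphic [w ! i, w ! j, w ! (j + 1)] [1, 2, 3])"

text \<open>The second disjunct is the convention that the empty permutation begins with the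
  pattern \<open>1\<close>.\<close>

definition begins_with :: "nat list \<Rightarrow> nat list \<Rightarrow> bool" where
  "begins_with p w \<longleftrightarrow>
     length p \<le> length w \<and> order_isomorphic (take (length p) w) p \<or> w = [] \<and> p = [1]"

definition N_1_23 :: "nat list \<Rightarrow> nat \<Rightarrow> nat" where
  "N_1_23 p n =
     card {w \<in> permutations_of_set {1..n}. \<not> contains_1_23 w \<and> begins_with p w}"

definition E_1_23 :: "nat list \<Rightarrow> real fps" where
  "E_1_23 p = Abs_fps (\<lambda>n. real (N_1_23 p n) / fact n)"

text \<open>The pattern \<open>(k-1)(k-2)...1k\<close>, for \<open>k \<ge> 1\<close>.\<close>

definition desc_then_max :: "nat \<Rightarrow> nat list" where
  "desc_then_max k = rev [1..<k] @ [k]"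

end

theory Submission imports Defs begin

text \<open>Cutting an avoider at its smallest letter as \<open>u @ 1 # v\<close> forces \<open>v\<close> to be decreasing and \<open>u\<close> to
  be an avoider, so the avoiders are counted by the possible prefixes \<open>u\<close>. Hence
  \<open>N(n+1) = (\<Sum>i\<le>n. (n choose i) N(i))\<close>, plus \<open>(n-1 choose k-2)\<close> if \<open>k \<ge> 2\<close> and \<open>n \<ge> 1\<close> for the words in
  which the letter 1 is the penultimate letter of the initial pattern. The generating function
  therefore solves \<open>E' = e^x E + H\<close> with \<open>H' = x^(k-2) e^x / (k-2)!\<close>, and the integrating factor
  \<open>exp (- exp x)\<close> gives the formula for \<open>\<bar>x\<bar> < 1\<close>.\<close>

section \<open>Avoiders over an arbitrary finite alphabet, and their relabelling\<close>

lemma contains_1_23_iff: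
  "contains_1_23 w \<longleftrightarrow>
     (\<exists>i j. i < j \<and> j + 1 < length w \<and> w ! i < w ! j \<and> w ! j < w ! (j + 1))"
proof -
  have "order_isomorphic [a, b, c] [1, 2, 3] \<longleftrightarrow> a < b \<and> b < c" for a b c :: nat
    by (auto simp: order_isomorphic_def less_Suc_eq numeral_3_eq_3 nth_Cons split: nat.splits)
  then show ?thesis
    by (simp add: contains_1_23_def)
qed

text \<open>Stated for an arbitrary alphabet \<open>A\<close>, because a prefix of a permutation of
  \<open>{1..n}\<close> uses some subset of the letters and not an initial segment.\<close>

definition good :: "nat list \<Rightarrow> nat set \<Rightarrow> nat list set" where
  "good p A = {w \<in> permutations_of_set A. \<not> contains_1_23 w \<and> begins_with p w}"

lemma N_1_23_eq_card_good: "N_1_23 p n = card (good p {1..n})"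
  by (simp add: N_1_23_def good_def)

lemma finite_good: "finite (good p A)"
  unfolding good_def by (rule finite_subset[OF _ finite_permutations_of_set[of A]]) auto

lemma order_isomorphic_map:
  assumes "strict_mono_on (set w) f"
  shows "order_isomorphic (map f w) p \<longleftrightarrow> order_isomorphic w p"
proof -
  have "f (w ! i) < f (w ! j) \<longleftrightarrow> w ! i < w ! j" if "i < length w" "j < length w" for i j
    using assms that by (simp add: strict_mono_on_less)
  then show ?thesis
    by (simp add: order_isomorphic_def)
qed

lemma contains_1_23_map:
  assumes "strict_mono_on (set w) f"
  shows "contains_1_23 (map f w) \<longleftrightarrow> contains_1_23 w"
proof -
  have less: "f (w ! i) < f (w ! j) \<longleftrightarrow> w ! i < w ! j" if "i < length w" "j < length w" for i j
    using assms that by (simp add: strict_mono_on_less)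
  have "map f w ! i < map f w ! j \<and> map f w ! j < map f w ! (j + 1) \<longleftrightarrow>
      w ! i < w ! j \<and> w ! j < w ! (j + 1)" if "i < j" "j + 1 < length w" for i j
    using that less[of i j] less[of j "j + 1"] by simp
  then show ?thesis
    unfolding contains_1_23_iff length_map by blast
qed

lemma begins_with_map:
  assumes "strict_mono_on (set w) f"
  shows "begins_with p (map f w) \<longleftrightarrow> begins_with p w"
proof -
  have "strict_mono_on (set (take (length p) w)) f"
    using assms by (auto simp: strict_mono_on_def dest: in_set_takeD)
  then show ?thesis
    by (simp add: begins_with_def take_map order_isomorphic_map)
qed

lemma good_image:
  assumes "strict_mono_on A f"
  shows "good p (f ` A) = map f ` good p A"
proof -
  have "contains_1_23 (map f w) \<longleftrightarrow> contains_1_23 w"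
    "begins_with p (map f w) \<longleftrightarrow> begins_with p w" if "w \<in> permutations_of_set A" for w
    using assms permutations_of_setD(1)[OF that] contains_1_23_map begins_with_map by blast+
  then show ?thesis
    using permutations_of_set_image_inj[OF strict_mono_on_imp_inj_on[OF assms]]
    by (auto simp: good_def)
qed

text \<open>Both conditions compare letters only by their order, so the increasing bijection from
  \<open>{1..card A}\<close> to \<open>A\<close> carries one set of words onto the other.\<close>

lemma card_good:
  assumes "finite A"
  shows "card (good p A) = N_1_23 p (card A)"
proof -
  obtain r where r: "strict_mono_on {..<card A} r" "\<forall>n<card A. r n \<in> A"
    using finite_enumerate[OF assms] by blast
  \<comment> \<open>The enumeration \<open>r\<close> starts at 0, while the standard alphabet starts
    at 1.\<close>
  define f where "f = (\<lambda>i. r (i - 1))"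
  have mono: "strict_mono_on {1..card A} f"
    by (rule strict_mono_onI) (auto simp: f_def intro!: strict_mono_onD[OF r(1)])
  have "f ` {1..card A} = A"
  proof (rule card_subset_eq[OF assms])
    show "f ` {1..card A} \<subseteq> A"
      using r(2) by (auto simp: f_def)
    show "card (f ` {1..card A}) = card A"
      using strict_mono_on_imp_inj_on[OF mono] by (simp add: card_image)
  qed
  then have "good p A = map f ` good p {1..card A}"
    using good_image[OF mono] by simp
  moreover have "inj_on (map f) (good p {1..card A})"
  proof (rule inj_onI)
    fix v w assume "v \<in> good p {1..card A}" "w \<in> good p {1..card A}" "map f v = map f w"
    moreover from this have "set v \<union> set w = {1..card A}"
      by (auto simp: good_def dest: permutations_of_setD(1))
    ultimately show "v = w"
      using strict_mono_on_imp_inj_on[OF mono] inj_on_map_eq_map by metis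
  qed
  ultimately show ?thesis
    by (simp add: N_1_23_eq_card_good card_image)
qed

section \<open>Avoidance when a word is cut at its smallest letter\<close>

text \<open>The smallest letter \<open>m\<close> can only play the 1 of an occurrence, so the
  adjacent pair playing 23 lies entirely in \<open>u\<close> or entirely in \<open>v\<close>. A pair
  in \<open>u\<close> gives an occurrence in \<open>u\<close>; a pair in \<open>v\<close> is an
  ascent of \<open>v\<close>, and \<open>m\<close> completes every such ascent to an occurrence. As
  \<open>v\<close> is distinct, having no ascent means being decreasing.\<close>

lemma contains_1_23_append_min:
  assumes "distinct v" and m: "\<And>x. x \<in> set u \<union> set v \<Longrightarrow> m < x"
  shows "contains_1_23 (u @ m # v) \<longleftrightarrow> contains_1_23 u \<or> \<not> sorted_wrt (>) v"
proof
  assume "contains_1_23 (u @ m # v)"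
  then obtain i j where ij: "i < j" "j + 1 < length (u @ m # v)"
    "(u @ m # v) ! i < (u @ m # v) ! j" "(u @ m # v) ! j < (u @ m # v) ! (j + 1)"
    by (auto simp: contains_1_23_iff)
  consider "j + 1 < length u" | "j + 1 = length u" | "j = length u" | "j > length u" by linarith
  then show "contains_1_23 u \<or> \<not> sorted_wrt (>) v"
  proof cases
    case 1
    then show ?thesis
      using ij by (auto simp: contains_1_23_iff nth_append)
  next
    case 2
    then have "u ! j < m" "u ! j \<in> set u"
      using ij by (auto simp: nth_append)
    then show ?thesis using m[of "u ! j"] by simp
  next
    case 3
    then have "u ! i < m" "u ! i \<in> set u"
      using ij by (auto simp: nth_append)
    then show ?thesis using m[of "u ! i"] by simp
  next
    case 4
    then obtain l where l: "j = length u + Suc l"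
      using less_imp_Suc_add by auto
    then have "v ! l < v ! Suc l" "Suc l < length v"
      using ij by (auto simp: nth_append)
    then show ?thesis
      using sorted_wrt_nth_less[of "(>)" v l "Suc l"] by auto
  qed
next
  assume "contains_1_23 u \<or> \<not> sorted_wrt (>) v"
  then show "contains_1_23 (u @ m # v)"
  proof
    assume "contains_1_23 u"
    then obtain i j where "i < j" "j + 1 < length u" "u ! i < u ! j" "u ! j < u ! (j + 1)"
      by (auto simp: contains_1_23_iff)
    then show ?thesis
      unfolding contains_1_23_iff
      by (intro exI[of _ i] exI[of _ j]) (auto simp: nth_append)
  next
    assume "\<not> sorted_wrt (>) v"
    then obtain l where l: "Suc l < length v" "\<not> v ! Suc l < v ! l"
      by (auto simp: sorted_wrt_iff_nth_Suc_transp)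
    then have "v ! l < v ! Suc l"
      using \<open>distinct v\<close> by (metis Suc_lessD linorder_neqE_nat n_not_Suc_n nth_eq_iff_index_eq)
    moreover have "m < v ! l"
      using l m[of "v ! l"] by simp
    ultimately show ?thesis
      unfolding contains_1_23_iff using l
      \<comment> \<open>The letter \<open>m\<close> at position \<open>length u\<close> plays the 1;
        position \<open>l\<close> of \<open>v\<close> is position \<open>length u + 1 + l\<close> of
        the whole word.\<close>
      by (intro exI[of _ "length u"] exI[of _ "Suc (length u + l)"]) (auto simp: nth_append)
  qed
qed

section \<open>The initial pattern and its position relative to the smallest letter\<close>

lemma order_isomorphic_desc_then_max:
  assumes "length w = k" "k \<ge> 1"
  shows "order_isomorphic w (desc_then_max k) \<longleftrightarrow>
    sorted_wrt (>) (take (k - 1) w) \<and> (\<forall>x \<in> set (take (k - 1) w). x < w ! (k - 1))"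
proof -
  have len: "length (desc_then_max k) = k"
    using assms by (simp add: desc_then_max_def)
  have nth: "desc_then_max k ! i = (if i = k - 1 then k else k - 1 - i)" if "i < k" for i
    using that by (auto simp: desc_then_max_def nth_append rev_nth)
  show ?thesis
  proof
    assume iso: "order_isomorphic w (desc_then_max k)"
    have *: "w ! i < w ! j \<longleftrightarrow> desc_then_max k ! i < desc_then_max k ! j" if "i < k" "j < k" for i j
      using iso that assms by (auto simp: order_isomorphic_def)
    have "w ! j < w ! i" if "i < j" "j < k - 1" for i j
      using that *[of j i] by (auto simp: nth)
    moreover have "w ! i < w ! (k - 1)" if "i < k - 1" for i
      using that *[of i "k - 1"] by (auto simp: nth)
    ultimately show "sorted_wrt (>) (take (k - 1) w) \<and>
        (\<forall>x \<in> set (take (k - 1) w). x < w ! (k - 1))"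
      using assms by (auto simp: sorted_wrt_iff_nth_less set_conv_nth)
  next
    assume R: "sorted_wrt (>) (take (k - 1) w) \<and>
        (\<forall>x \<in> set (take (k - 1) w). x < w ! (k - 1))"
    then have desc: "w ! j < w ! i" if "i < j" "j < k - 1" for i j
      using that assms by (auto simp: sorted_wrt_iff_nth_less)
    have top: "w ! i < w ! (k - 1)" if "i < k - 1" for i
    proof -
      have "w ! i \<in> set (take (k - 1) w)"
        using that assms by (auto simp: in_set_conv_nth intro!: exI[of _ i])
      then show ?thesis using R by blast
    qed
    have "w ! i < w ! j \<longleftrightarrow> desc_then_max k ! i < desc_then_max k ! j" if "i < k" "j < k" for i j
    proof -
      consider "i = k - 1" "j = k - 1" | "i = k - 1" "j < k - 1" | "i < k - 1" "j = k - 1"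
        | "i < k - 1" "j < k - 1" "i < j" | "i < k - 1" "j < k - 1" "j \<le> i"
        using \<open>i < k\<close> \<open>j < k\<close> by linarith
      then show ?thesis
      proof cases
        case 1 then show ?thesis by simp
      next
        case 2 then show ?thesis using top[of j] that by (simp add: nth)
      next
        case 3 then show ?thesis using top[of i] that by (simp add: nth)
      next
        case 4 then show ?thesis using desc[of i j] that by (simp add: nth)
      next
        case 5
        then show ?thesis using desc[of j i] that by (cases "i = j") (auto simp: nth)
      qed
    qed
    then show "order_isomorphic w (desc_then_max k)"
      using len assms by (simp add: order_isomorphic_def)
  qed
qed

lemma length_desc_then_max [simp]: "k \<ge> 1 \<Longrightarrow> length (desc_then_max k) = k"
  by (simp add: desc_then_max_def)

lemma begins_with_desc_then_max:
  assumes "k \<ge> 2"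
  shows "begins_with (desc_then_max k) w \<longleftrightarrow> k \<le> length w \<and>
    sorted_wrt (>) (take (k - 1) w) \<and> (\<forall>x \<in> set (take (k - 1) w). x < w ! (k - 1))"
proof -
  \<comment> \<open>The convention for the empty word concerns the pattern \<open>[1]\<close> only,
    and the lengths differ.\<close>
  have "desc_then_max k \<noteq> [1]"
    using assms length_desc_then_max[of k] by (metis One_nat_def Suc_1 add_leE length_Cons
      list.size(3) not_less_eq_eq order_refl plus_1_eq_Suc)
  then show ?thesis
    using order_isomorphic_desc_then_max[of "take k w" k] assms
    by (auto simp: begins_with_def min_def)
qed

text \<open>The convention for the empty word enters here: with it, \<open>k = 1\<close> counts all
  avoiders.\<close>

lemma begins_with_desc_then_max_1: "begins_with (desc_then_max 1) w"
  by (cases w) (auto simp: begins_with_def desc_then_max_def order_isomorphic_def)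

text \<open>The cases follow the position of \<open>m\<close> among the first \<open>k\<close>
  letters. Beyond them, the pattern lies in \<open>u\<close>. In the last place, \<open>m\<close>
  would have to exceed the letters of the nonempty \<open>u\<close>. In the penultimate place,
  \<open>m\<close> is the 1 of the pattern and the first letter of \<open>v\<close> is its
  \<open>k\<close>. Any earlier, a larger letter would follow \<open>m\<close> inside the decreasing
  part.\<close>

lemma begins_with_append_min:
  assumes "k \<ge> 2" and m: "\<And>x. x \<in> set u \<union> set v \<Longrightarrow> m < x"
  shows "begins_with (desc_then_max k) (u @ m # v) \<longleftrightarrow> begins_with (desc_then_max k) u \<or>
    length u = k - 2 \<and> sorted_wrt (>) u \<and> v \<noteq> [] \<and> (\<forall>x \<in> set u. x < hd v)"
proof -
  consider "k \<le> length u" | "length u = k - 1" | "length u = k - 2" | "length u < k - 2"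
    by linarith
  then show ?thesis
  proof cases
    case 1
    then show ?thesis
      using assms by (auto simp: begins_with_desc_then_max nth_append)
  next
    case 2
    then have "u \<noteq> []" using assms by auto
    then have "\<not> (\<forall>x\<in>set u. x < m)"
      using m[of "hd u"] by (metis UnI1 hd_in_set not_less_iff_gr_or_eq)
    moreover have "take (k - 1) (u @ m # v) = u" "(u @ m # v) ! (k - 1) = m"
      using 2 by (simp, metis nth_append_length)
    ultimately have "\<not> begins_with (desc_then_max k) (u @ m # v)"
      by (auto simp only: begins_with_desc_then_max[OF \<open>k \<ge> 2\<close>])
    moreover have "\<not> k \<le> length u" "length u \<noteq> k - 2"
      using 2 assms by auto
    ultimately show ?thesis
      by (simp add: begins_with_desc_then_max[OF \<open>k \<ge> 2\<close>])
  next
    case 3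
    then have len: "k - 1 = Suc (length u)" "k = Suc (Suc (length u))"
      using assms by auto
    have "take (k - 1) (u @ m # v) = u @ [m]"
      by (simp add: len(2))
    moreover have "(u @ m # v) ! (k - 1) = hd v" if "v \<noteq> []"
      using that by (simp add: len(2) nth_append hd_conv_nth)
    moreover have "k \<le> length (u @ m # v) \<longleftrightarrow> v \<noteq> []"
      using len(2) by (cases v) auto
    ultimately have "begins_with (desc_then_max k) (u @ m # v) \<longleftrightarrow>
        v \<noteq> [] \<and> sorted_wrt (>) (u @ [m]) \<and> (\<forall>x \<in> set (u @ [m]). x < hd v)"
      unfolding begins_with_desc_then_max[OF \<open>k \<ge> 2\<close>] by metis
    moreover have "\<not> begins_with (desc_then_max k) u"
      unfolding begins_with_desc_then_max[OF \<open>k \<ge> 2\<close>] using len(2) by simp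
    moreover have "m < hd v" if "v \<noteq> []"
      using that m by simp
    ultimately show ?thesis
      using 3 m by (auto simp: sorted_wrt_append)
  next
    case 4
    \<comment> \<open>In this form of \<open>k\<close> it is visible that \<open>m\<close> and the
      letter after it both lie among the first \<open>k - 1\<close> letters.\<close>
    then obtain l where l: "k = length u + Suc (Suc (Suc l))"
      using that[of "k - 3 - length u"] by simp
    have False if long: "k \<le> length (u @ m # v)" and desc: "sorted_wrt (>) (take (k - 1) (u @ m # v))"
    proof -
      obtain y ys where "v = y # ys"
        using long l by (cases v) auto
      then show False
        using desc m[of y] l by (auto simp: sorted_wrt_append)
    qed
    then show ?thesis
      using 4 by (auto simp: begins_with_desc_then_max[OF \<open>k \<ge> 2\<close>])
  qed
qed

section \<open>Decreasing words, and the avoiders parametrized by their prefixes\<close>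

definition desc_list :: "nat set \<Rightarrow> nat list" where
  "desc_list A = rev (sorted_list_of_set A)"

lemma set_desc_list [simp]: "finite A \<Longrightarrow> set (desc_list A) = A"
  and distinct_desc_list [simp]: "distinct (desc_list A)"
  and length_desc_list [simp]: "length (desc_list A) = card A"
  and sorted_desc_list [simp]: "sorted_wrt (>) (desc_list A)"
  by (simp_all add: desc_list_def sorted_wrt_rev)

text \<open>Makes the decreasing tail a function of its letters, hence of the prefix
  \<open>u\<close>.\<close>

lemma desc_list_unique: "sorted_wrt (>) v \<Longrightarrow> v = desc_list (set v)"
  by (metis desc_list_def rev_rev_ident sorted_list_of_set.idem_if_sorted_distinct
    sorted_wrt_rev set_rev strict_sorted_iff)

lemma not_contains_1_23_desc: "sorted_wrt (>) w \<Longrightarrow> \<not> contains_1_23 w"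
  by (fastforce simp: contains_1_23_iff sorted_wrt_iff_nth_less)

lemma hd_desc_list:
  assumes "finite A" "A \<noteq> {}"
  shows "hd (desc_list A) = Max A"
proof -
  obtain y ys where ys: "desc_list A = y # ys"
    using assms by (metis length_desc_list card_0_eq length_0_conv list.exhaust)
  then have "Max A = y"
    using sorted_desc_list[of A] set_desc_list[OF assms(1)]
    by (intro Max_eqI) (auto simp: assms)
  then show ?thesis by (simp add: ys)
qed

text \<open>In the second set \<open>u\<close> is the decreasing run before \<open>m\<close>, and the letter after \<open>m\<close>, being the
  largest of the remaining ones, exceeds all of \<open>u\<close> iff \<open>Max B\<close> is not in \<open>u\<close>.\<close>

lemma good_insert_min:
  assumes "finite B" and m: "\<And>x. x \<in> B \<Longrightarrow> m < x" and "k \<ge> 1"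
  shows "good (desc_then_max k) (insert m B) =
    (\<lambda>u. u @ m # desc_list (B - set u)) `
      ((\<Union>U\<in>Pow B. good (desc_then_max k) U) \<union>
        (if k \<ge> 2 \<and> B \<noteq> {} then desc_list ` {U. U \<subseteq> B - {Max B} \<and> card U = k - 2} else {}))"
    (is "_ = ?f ` (?S1 \<union> ?S2)")
proof -
  have "m \<notin> B" using m by blast
  have begins: "begins_with (desc_then_max k) (?f u) \<longleftrightarrow>
      begins_with (desc_then_max k) u \<or> u \<in> ?S2"
    if "set u \<subseteq> B" "distinct u" for u
  proof (cases "k = 1")
    case True
    then show ?thesis using begins_with_desc_then_max_1 by simp
  next
    case False
    then have k: "k \<ge> 2" using \<open>k \<ge> 1\<close> by simp
    have fin: "finite (B - set u)" using assms by simp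
    \<comment> \<open>This is the second alternative of \<open>begins_with_append_min\<close> for
      the tail \<open>desc_list (B - set u)\<close>.\<close>
    have "length u = k - 2 \<and> sorted_wrt (>) u \<and> desc_list (B - set u) \<noteq> [] \<and>
        (\<forall>x \<in> set u. x < hd (desc_list (B - set u))) \<longleftrightarrow> u \<in> ?S2" (is "?L \<longleftrightarrow> _")
    proof
      assume L: ?L
      moreover have "desc_list {} = []"
        by (simp add: desc_list_def)
      ultimately have ne: "B - set u \<noteq> {}"
        by metis
      then have lt: "\<forall>x \<in> set u. x < Max (B - set u)"
        using L hd_desc_list[OF fin] by simp
      have "Max B \<notin> set u"
      proof
        assume "Max B \<in> set u"
        then have "Max B < Max (B - set u)" using lt by blast
        moreover have "Max (B - set u) \<le> Max B"
          using ne assms by (intro Max_mono) auto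
        ultimately show False by simp
      qed
      moreover have "u = desc_list (set u)" "card (set u) = k - 2"
        using L desc_list_unique distinct_card[OF \<open>distinct u\<close>] by auto
      ultimately show "u \<in> ?S2"
        using that k ne by auto
    next
      assume "u \<in> ?S2"
      then obtain U where U: "B \<noteq> {}" "U \<subseteq> B - {Max B}" "card U = k - 2" "u = desc_list U"
        by (auto split: if_splits)
      have "finite U" using U(2) assms by (meson finite_Diff finite_subset)
      then have u: "set u = U" "length u = k - 2" "sorted_wrt (>) u"
        using U by auto
      have "Max B \<in> B - set u"
        using U u assms by auto
      then have ne: "B - set u \<noteq> {}" by blast
      have "x < Max (B - set u)" if "x \<in> set u" for x
      proof -
        have "x < Max B"
          using that U u assms by (metis Diff_iff Max_ge insertI1 nless_le subsetD)
        also have "\<dots> \<le> Max (B - set u)"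
          using fin \<open>Max B \<in> B - set u\<close> by simp
        finally show ?thesis .
      qed
      moreover have "desc_list (B - set u) \<noteq> []"
        using ne fin set_desc_list[of "B - set u"] by (metis list.set(1))
      ultimately show ?L
        using u hd_desc_list[OF fin ne] by auto
    qed
    moreover have "m < x" if "x \<in> set u \<union> set (desc_list (B - set u))" for x
      using that \<open>set u \<subseteq> B\<close> fin m by auto
    ultimately show ?thesis
      using begins_with_append_min[OF k, of u "desc_list (B - set u)" m] by blast
  qed
  have S2: "set u \<subseteq> B \<and> distinct u \<and> \<not> contains_1_23 u" if "u \<in> ?S2" for u
  proof -
    have "u \<in> desc_list ` {U. U \<subseteq> B - {Max B} \<and> card U = k - 2}"
      using that by (simp split: if_splits)
    then obtain U where U: "U \<subseteq> B - {Max B}" "u = desc_list U" by blast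
    then have "finite U" using assms by (meson finite_Diff finite_subset)
    then show ?thesis using U by (auto simp: not_contains_1_23_desc)
  qed
  \<comment> \<open>The index \<open>U\<close> of the union is just the set of letters of
    \<open>u\<close>.\<close>
  have S1: "u \<in> ?S1 \<longleftrightarrow> set u \<subseteq> B \<and> distinct u \<and> \<not> contains_1_23 u \<and>
      begins_with (desc_then_max k) u" for u
    by (auto simp: good_def permutations_of_set_def)
  have contains: "contains_1_23 (?f u) \<longleftrightarrow> contains_1_23 u"
    if "set u \<subseteq> B" for u
    using contains_1_23_append_min[of "desc_list (B - set u)" u m] that m assms by auto
  show ?thesis
  proof (intro equalityI subsetI)
    fix w assume w: "w \<in> good (desc_then_max k) (insert m B)"
    then have perm: "set w = insert m B" "distinct w" and
      av: "\<not> contains_1_23 w" and beg: "begins_with (desc_then_max k) w"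
      by (auto simp: good_def permutations_of_set_def)
    obtain u v where uv: "w = u @ m # v"
      using perm(1) by (metis insertI1 split_list)
    \<comment> \<open>Since no letter repeats, the tail uses exactly the letters missing from
      \<open>u\<close>.\<close>
    have sets: "set u \<subseteq> B" "distinct u" "distinct v" "set v = B - set u"
      using perm uv \<open>m \<notin> B\<close> by auto
    then have "\<not> contains_1_23 u" "sorted_wrt (>) v"
      using contains_1_23_append_min[of v u m] av m unfolding uv by auto
    then have "w = ?f u"
      using desc_list_unique[of v] sets uv by simp
    then have "u \<in> ?S1 \<union> ?S2"
      using begins[of u] S1[of u] sets \<open>\<not> contains_1_23 u\<close> beg by blast
    then show "w \<in> ?f ` (?S1 \<union> ?S2)"
      using \<open>w = ?f u\<close> by blast
  next
    fix w assume "w \<in> ?f ` (?S1 \<union> ?S2)"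
    then obtain u where u: "u \<in> ?S1 \<union> ?S2" "w = ?f u" by blast
    then have sets: "set u \<subseteq> B" "distinct u" and "\<not> contains_1_23 u"
      using S1[of u] S2[of u] by blast+
    moreover have "begins_with (desc_then_max k) w"
      using begins[OF sets] u S1[of u] by blast
    moreover have "set w = insert m B" "distinct w"
      using sets u(2) assms \<open>m \<notin> B\<close> by auto
    ultimately show "w \<in> good (desc_then_max k) (insert m B)"
      using contains u(2) by (auto simp: good_def permutations_of_set_def)
  qed
qed

section \<open>The recurrence for the counts\<close>

lemma sum_Pow_card:
  assumes "finite B"
  shows "(\<Sum>U\<in>Pow B. g (card U)) = (\<Sum>i\<le>card B. (card B choose i) * g i)"
proof -
  have "(\<Sum>U\<in>Pow B. g (card U)) = (\<Sum>i\<le>card B. \<Sum>U | U \<in> Pow B \<and> card U = i. g (card U))"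
    using assms by (intro sum.group[symmetric]) (auto simp: card_mono)
  also have "\<dots> = (\<Sum>i\<le>card B. (card B choose i) * g i)"
    using n_subsets[OF assms] by (intro sum.cong) simp_all
  finally show ?thesis .
qed

text \<open>\<open>good_insert_min\<close> with \<open>m = 1\<close> and
  \<open>B = {2..Suc n}\<close> reduces the count to prefixes. Prefixes that already begin with the
  pattern are grouped by the size of their letter set and give the sum; the remaining ones
  correspond to the \<open>(k - 2)\<close>-subsets of \<open>B - {Max B}\<close>.\<close>

lemma N_1_23_Suc:
  assumes "k \<ge> 1"
  shows "N_1_23 (desc_then_max k) (Suc n) =
    (\<Sum>i\<le>n. (n choose i) * N_1_23 (desc_then_max k) i) +
    (if k \<ge> 2 \<and> n \<ge> 1 then (n - 1) choose (k - 2) else 0)"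
proof -
  define B where "B = {2..Suc n}"
  let ?p = "desc_then_max k"
  let ?S1 = "\<Union>U\<in>Pow B. good ?p U"
  let ?S2 = "if k \<ge> 2 \<and> B \<noteq> {} then desc_list ` {U. U \<subseteq> B - {Max B} \<and> card U = k - 2} else {}"
  let ?f = "\<lambda>u. u @ 1 # desc_list (B - set u)"
  have B: "finite B" "card B = n" "{1..Suc n} = insert 1 B" "\<And>x. x \<in> B \<Longrightarrow> 1 < x"
    by (auto simp: B_def)
  have finU: "finite U" if "U \<subseteq> B" for U
    using that B(1) finite_subset by blast
  have fin: "finite ?S1" "finite ?S2"
    using B(1) finite_good by auto
  have sets: "set u \<subseteq> B" if "u \<in> ?S1 \<union> ?S2" for u
  proof -
    have "set (desc_list U) \<subseteq> B" if "U \<subseteq> B - {Max B}" for U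
      using that finU[of U] set_desc_list[of U] by blast
    then show ?thesis
      using that by (auto simp: good_def permutations_of_set_def split: if_splits)
  qed
  have "inj_on ?f (?S1 \<union> ?S2)"
  proof (rule inj_onI)
    fix u u' assume *: "u \<in> ?S1 \<union> ?S2" "u' \<in> ?S1 \<union> ?S2" "?f u = ?f u'"
    \<comment> \<open>The prefix is recovered as the part of the word before the letter 1, which
      gives injectivity.\<close>
    have before_1: "takeWhile (\<lambda>x. x \<noteq> 1) (w @ 1 # v) = w" if "1 \<notin> set w" for v w :: "nat list"
      using that by (induction w) auto
    have "1 \<notin> set u" "1 \<notin> set u'"
      using * sets B(4) by blast+
    then have "takeWhile (\<lambda>x. x \<noteq> 1) (?f u) = u" "takeWhile (\<lambda>x. x \<noteq> 1) (?f u') = u'"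
      using before_1 by blast+
    then show "u = u'" using *(3) by metis
  qed
  moreover have "N_1_23 ?p (Suc n) = card (?f ` (?S1 \<union> ?S2))"
    unfolding N_1_23_eq_card_good B(3) by (subst good_insert_min) (use B assms in auto)
  ultimately have "N_1_23 ?p (Suc n) = card (?S1 \<union> ?S2)"
    by (simp add: card_image)
  also have "\<dots> = card ?S1 + card ?S2"
  proof (rule card_Un_disjoint[OF fin])
    \<comment> \<open>The two families of prefixes are told apart by their lengths: at least
      \<open>k\<close> against \<open>k - 2\<close>. For \<open>k = 1\<close> the second one is
      empty.\<close>
    have "length u \<ge> k" if "u \<in> ?S1" "k \<ge> 2" for u
      using that by (auto simp: good_def begins_with_desc_then_max)
    moreover have "length u = k - 2 \<and> k \<ge> 2" if "u \<in> ?S2" for u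
      using that by (auto split: if_splits)
    ultimately show "?S1 \<inter> ?S2 = {}" by fastforce
  qed
  also have "card ?S1 = (\<Sum>U\<in>Pow B. card (good ?p U))"
    by (rule card_UN_disjoint)
       (use B(1) finite_good in \<open>auto simp: good_def permutations_of_set_def\<close>)
  also have "\<dots> = (\<Sum>U\<in>Pow B. N_1_23 ?p (card U))"
    using finU by (intro sum.cong) (auto simp: card_good)
  also have "\<dots> = (\<Sum>i\<le>n. (n choose i) * N_1_23 ?p i)"
    using sum_Pow_card[OF B(1)] B(2) by simp
  also have "card ?S2 = (if k \<ge> 2 \<and> n \<ge> 1 then (n - 1) choose (k - 2) else 0)"
  proof -
    have "inj_on desc_list {U. U \<subseteq> B - {Max B} \<and> card U = k - 2}"
    proof (rule inj_onI)
      fix U V assume "U \<in> {U. U \<subseteq> B - {Max B} \<and> card U = k - 2}"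
        "V \<in> {U. U \<subseteq> B - {Max B} \<and> card U = k - 2}" "desc_list U = desc_list V"
      moreover from this have "finite U" "finite V"
        by (auto intro: finU)
      ultimately show "U = V"
        using set_desc_list by metis
    qed
    moreover have "card (B - {Max B}) = n - 1" if "B \<noteq> {}"
      using that B by simp
    moreover have "B \<noteq> {} \<longleftrightarrow> n \<ge> 1"
      by (auto simp: B_def)
    ultimately show ?thesis
      using B(1) n_subsets[of "B - {Max B}" "k - 2"] by (auto simp: card_image)
  qed
  finally show ?thesis .
qed

section \<open>Convergence of the generating function and its differential equation\<close>

lemma N_1_23_le_fact: "N_1_23 p n \<le> fact n"
proof -
  have "N_1_23 p n \<le> card (permutations_of_set {1..n})"
    unfolding N_1_23_def by (intro card_mono) auto
  then show ?thesis by simp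
qed

text \<open>The coefficients lie between 0 and 1, so the geometric series dominates. Convergence is
  what lets the formal series be treated as a function.\<close>

lemma fps_conv_radius_E_1_23: "fps_conv_radius (E_1_23 p) \<ge> 1"
  unfolding fps_conv_radius_def one_ereal_def
proof (rule conv_radius_geI_ex')
  fix r :: real assume r: "0 < r" "ereal r < ereal 1"
  show "summable (\<lambda>n. fps_nth (E_1_23 p) n * of_real r ^ n)"
  proof (rule summable_comparison_test')
    show "summable (\<lambda>n. r ^ n)"
      using r by simp
    fix n :: nat
    have "real (N_1_23 p n) \<le> fact n"
      using N_1_23_le_fact[of p n] by (metis of_nat_fact of_nat_le_iff)
    then show "norm (fps_nth (E_1_23 p) n * of_real r ^ n) \<le> r ^ n"
      using r by (simp add: E_1_23_def abs_mult divide_simps mult_right_mono)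
  qed
qed

text \<open>The derivative of an exponential generating function shifts the index of the counts, and
  the binomial convolution in \<open>N_1_23_Suc\<close> becomes multiplication by e^x.\<close>

lemma fps_deriv_E_1_23:
  assumes "k \<ge> 1"
  shows "fps_deriv (E_1_23 (desc_then_max k)) =
    fps_exp 1 * E_1_23 (desc_then_max k) +
    Abs_fps (\<lambda>n. (if k \<ge> 2 \<and> n \<ge> 1 then real ((n - 1) choose (k - 2)) else 0) / fact n)"
proof (rule fps_ext)
  fix n
  let ?N = "N_1_23 (desc_then_max k)"
  have "fps_nth (fps_deriv (E_1_23 (desc_then_max k))) n = real (?N (Suc n)) / fact n"
    by (simp add: E_1_23_def divide_simps del: of_nat_Suc)
  also have "\<dots> = (\<Sum>i\<le>n. real (n choose i) * real (?N i) / fact n) +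
      (if k \<ge> 2 \<and> n \<ge> 1 then real ((n - 1) choose (k - 2)) else 0) / fact n"
    by (simp add: N_1_23_Suc[OF assms] add_divide_distrib sum_divide_distrib)
  also have "(\<Sum>i\<le>n. real (n choose i) * real (?N i) / fact n) =
      (\<Sum>i\<le>n. real (?N i) / fact i * (1 / fact (n - i)))"
    by (intro sum.cong) (simp_all add: binomial_fact)
  also have "\<dots> = fps_nth (E_1_23 (desc_then_max k) * fps_exp 1) n"
    by (simp add: fps_mult_nth E_1_23_def atLeast0AtMost)
  finally show "fps_nth (fps_deriv (E_1_23 (desc_then_max k))) n = fps_nth (fps_exp 1 *
      E_1_23 (desc_then_max k) + Abs_fps (\<lambda>n. (if k \<ge> 2 \<and> n \<ge> 1
        then real ((n - 1) choose (k - 2)) else 0) / fact n)) n"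
    by (simp add: mult.commute)
qed

text \<open>Differentiation undoes the shift from \<open>n\<close> to \<open>n - 1\<close>; what is
  left is the exponential generating function of \<open>n choose m\<close>, namely x^m e^x /
  m!.\<close>

lemma fps_deriv_shifted_binomial_egf:
  "fps_deriv (Abs_fps (\<lambda>n. (if n \<ge> 1 then real ((n - 1) choose m) else 0) / fact n)) =
    fps_const (1 / fact m) * fps_X ^ m * fps_exp (1::real)"
proof (rule fps_ext)
  fix n
  have "fps_nth (fps_deriv (Abs_fps (\<lambda>n. (if n \<ge> 1 then real ((n - 1) choose m) else 0) / fact n))) n =
      real (n choose m) / fact n"
    by (simp add: divide_simps del: of_nat_Suc)
  also have "\<dots> = fps_nth (fps_const (1 / fact m) * fps_X ^ m * fps_exp (1::real)) n"
    by (simp add: fps_X_power_mult_nth mult.assoc binomial_fact binomial_eq_0)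
  finally show "fps_nth (fps_deriv (Abs_fps (\<lambda>n. (if n \<ge> 1 then real ((n - 1) choose m) else 0)
      / fact n))) n = fps_nth (fps_const (1 / fact m) * fps_X ^ m * fps_exp 1) n" .
qed

section \<open>Solving the differential equation by integration\<close>

text \<open>The integrating factor \<open>exp (- exp t)\<close> cancels the term e^t E, so the
  product with E has derivative \<open>eval_fps H t * exp (- exp t)\<close>. The fundamental theorem
  of calculus between 0 and \<open>x\<close> then applies; \<open>exp (-1)\<close> is the factor at
  0.\<close>

lemma eval_fps_linear_ode:
  fixes E H :: "real fps"
  assumes ode: "fps_deriv E = fps_exp 1 * E + H"
    and rE: "ereal \<bar>x\<bar> < fps_conv_radius E" and rH: "ereal \<bar>x\<bar> < fps_conv_radius H"
  shows "eval_fps E x =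
    exp (exp x) * (fps_nth E 0 * exp (-1) + (LBINT t=0..ereal x. eval_fps H t * exp (- exp t)))"
proof -
  define F where "F = (\<lambda>t. eval_fps E t * exp (- exp t))"
  \<comment> \<open>\<open>x\<close> may be negative, so the segment from 0 to \<open>x\<close> is
    written with \<open>min\<close> and \<open>max\<close>.\<close>
  have in_dom: "ereal \<bar>t\<bar> < fps_conv_radius E" "ereal \<bar>t\<bar> < fps_conv_radius H"
    if "t \<in> {min 0 x..max 0 x}" for t
  proof -
    have "ereal \<bar>t\<bar> \<le> ereal \<bar>x\<bar>" using that by auto
    then show "ereal \<bar>t\<bar> < fps_conv_radius E" "ereal \<bar>t\<bar> < fps_conv_radius H"
      using rE rH by (metis order_le_less_trans)+
  qed
  have deriv: "(F has_real_derivative eval_fps H t * exp (- exp t)) (at t within A)"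
    if "t \<in> {min 0 x..max 0 x}" for t A
  proof -
    have "(eval_fps E has_real_derivative eval_fps (fps_exp 1 * E + H) t) (at t within A)"
      using has_field_derivative_eval_fps[of t E A] in_dom[OF that] by (simp add: ode)
    moreover have "eval_fps (fps_exp 1 * E + H) t = exp t * eval_fps E t + eval_fps H t"
    proof -
      have "ereal (norm t) < fps_conv_radius (fps_exp 1 * E)"
        using fps_conv_radius_mult[of "fps_exp 1" E] in_dom[OF that] by (simp add: less_le_trans)
      then show ?thesis
        using in_dom[OF that] by (simp add: eval_fps_add eval_fps_mult)
    qed
    ultimately have E': "(eval_fps E has_real_derivative exp t * eval_fps E t + eval_fps H t)
        (at t within A)" by simp
    show ?thesis
      unfolding F_def by (rule derivative_eq_intros E' refl)+ (simp add: algebra_simps)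
  qed
  have "continuous_on {min 0 x..max 0 x} (\<lambda>t. eval_fps H t * exp (- exp t))"
    using in_dom by (intro continuous_intros) auto
  then have "(LBINT t=ereal 0..ereal x. eval_fps H t * exp (- exp t)) = F x - F 0"
    using deriv by (intro interval_integral_FTC_finite)
      (auto simp: has_real_derivative_iff_has_vector_derivative[symmetric])
  then have "(LBINT t=0..ereal x. eval_fps H t * exp (- exp t)) = F x - F 0"
    by (simp add: zero_ereal_def)
  then show ?thesis
    by (simp add: F_def eval_fps_at_0 exp_minus field_simps)
qed

text \<open>Provides the inner integral of the formula, since a closed form is at hand for the
  derivative of \<open>H\<close> only.\<close>

lemma eval_fps_eq_interval_integral:
  fixes H :: "real fps"
  assumes "ereal \<bar>x\<bar> < fps_conv_radius H" "fps_nth H 0 = 0"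
  shows "eval_fps H x = (LBINT t=0..ereal x. eval_fps (fps_deriv H) t)"
proof -
  have in_dom: "ereal \<bar>t\<bar> < fps_conv_radius H" if "t \<in> {min 0 x..max 0 x}" for t
  proof -
    have "ereal \<bar>t\<bar> \<le> ereal \<bar>x\<bar>" using that by auto
    then show ?thesis using assms(1) by (metis order_le_less_trans)
  qed
  have "continuous_on {min 0 x..max 0 x} (eval_fps (fps_deriv H))"
    using in_dom less_le_trans[OF _ fps_conv_radius_deriv[of H]]
    by (intro continuous_on_eval_fps') auto
  then have "(LBINT t=ereal 0..ereal x. eval_fps (fps_deriv H) t) = eval_fps H x - eval_fps H 0"
    using in_dom by (intro interval_integral_FTC_finite)
      (auto simp: has_real_derivative_iff_has_vector_derivative[symmetric]
        intro!: has_field_derivative_eval_fps)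
  then show ?thesis
    using assms(2) by (simp add: zero_ereal_def eval_fps_at_0)
qed

section \<open>The closed formula on the interval |x| < 1\<close>

theorem proposition23:
  fixes k :: nat
  assumes "k \<ge> 1"
  shows "(\<lambda>x::real.
            if k \<ge> 2
            then exp (exp x) *
                 (LBINT t=0..ereal x. (LBINT r=0..ereal t. r ^ (k - 2) / fact (k - 2) * exp (r - exp t)))
            else exp (exp x - 1))
         has_fps_expansion E_1_23 (desc_then_max k)"
    (is "?f has_fps_expansion ?E")
proof -
  define H where "H = Abs_fps (\<lambda>n. (if k \<ge> 2 \<and> n \<ge> 1 then real ((n - 1) choose (k - 2)) else 0) / fact n)"
  have ode: "fps_deriv ?E = fps_exp 1 * ?E + H"
    using fps_deriv_E_1_23[OF assms] by (simp add: H_def)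
  have rE: "fps_conv_radius ?E \<ge> 1"
    by (rule fps_conv_radius_E_1_23)
  have rH: "fps_conv_radius H \<ge> 1"
  proof -
    \<comment> \<open>\<open>H\<close> is the difference E' - e^x E and inherits its radius of
      convergence from E.\<close>
    have "1 \<le> min (fps_conv_radius (fps_deriv ?E)) (fps_conv_radius (fps_exp 1 * ?E))"
      using rE fps_conv_radius_deriv[of ?E] fps_conv_radius_mult[of "fps_exp 1" ?E]
      by (auto intro: order_trans)
    also have "\<dots> \<le> fps_conv_radius (fps_deriv ?E - fps_exp 1 * ?E)"
      by (rule fps_conv_radius_diff)
    finally show ?thesis by (simp add: ode)
  qed
  \<comment> \<open>The initial value counts the empty permutation, which begins with the pattern
    exactly when \<open>k = 1\<close>.\<close>
  have E0: "fps_nth ?E 0 = (if k \<ge> 2 then 0 else 1)"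
  proof (cases "k \<ge> 2")
    case True
    then have "good (desc_then_max k) {} = {}"
      by (auto simp: good_def begins_with_desc_then_max)
    then show ?thesis using True by (simp add: E_1_23_def N_1_23_eq_card_good)
  next
    case False
    then have "k = 1" using assms by simp
    then have "good (desc_then_max k) {} = {[]}"
      using begins_with_desc_then_max_1 by (auto simp: good_def contains_1_23_iff)
    then show ?thesis using False by (simp add: E_1_23_def N_1_23_eq_card_good)
  qed
  have eval_E: "eval_fps ?E x = ?f x" if x: "\<bar>x\<bar> < 1" for x
  proof -
    have radius: "ereal \<bar>t\<bar> < fps_conv_radius ?E" "ereal \<bar>t\<bar> < fps_conv_radius H"
      if "\<bar>t\<bar> < 1" for t
    proof -
      have "ereal \<bar>t\<bar> < 1" using that by simp
      then show "ereal \<bar>t\<bar> < fps_conv_radius ?E" "ereal \<bar>t\<bar> < fps_conv_radius H"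
        using rE rH less_le_trans by blast+
    qed
    have sol: "eval_fps ?E x = exp (exp x) *
        (fps_nth ?E 0 * exp (-1) + (LBINT t=0..ereal x. eval_fps H t * exp (- exp t)))"
      by (rule eval_fps_linear_ode[OF ode radius[OF x]])
    show ?thesis
    proof (cases "k \<ge> 2")
      case False
      then have "H = 0" by (auto simp: H_def fps_eq_iff)
      then show ?thesis
        using sol False E0 by (simp add: exp_diff exp_minus field_simps)
    next
      case True
      have H': "fps_deriv H = fps_const (1 / fact (k - 2)) * fps_X ^ (k - 2) * fps_exp 1"
        using fps_deriv_shifted_binomial_egf[of "k - 2"] True by (simp add: H_def)
      have eval_H': "eval_fps (fps_deriv H) r = r ^ (k - 2) / fact (k - 2) * exp r" for r
      proof -
        \<comment> \<open>Infinite radius allows the product to be evaluated factor by factor at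
          every \<open>r\<close>.\<close>
        have "fps_conv_radius (fps_const (1 / fact (k - 2)) * fps_X ^ (k - 2) :: real fps) = \<infinity>"
          by (simp add: fps_conv_radius_cmult_left)
        then show ?thesis
          unfolding H' by (simp add: eval_fps_mult)
      qed
      have inner: "eval_fps H t * exp (- exp t) =
          (LBINT r=0..ereal t. r ^ (k - 2) / fact (k - 2) * exp (r - exp t))" if "\<bar>t\<bar> < 1" for t
      proof -
        have "fps_nth H 0 = 0" by (simp add: H_def)
        then have "eval_fps H t = (LBINT r=0..ereal t. r ^ (k - 2) / fact (k - 2) * exp r)"
          using eval_fps_eq_interval_integral[OF radius(2)[OF that]] by (simp add: eval_H')
        \<comment> \<open>The factor \<open>exp (- exp t)\<close> does not depend on
          \<open>r\<close> and moves under the inner integral.\<close>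
        then have "eval_fps H t * exp (- exp t) =
            (LBINT r=0..ereal t. (r ^ (k - 2) / fact (k - 2) * exp r) * exp (- exp t))"
          by simp
        also have "(\<lambda>r. (r ^ (k - 2) / fact (k - 2) * exp r) * exp (- exp t)) =
            (\<lambda>r. r ^ (k - 2) / fact (k - 2) * exp (r - exp t))"
          by (simp add: exp_diff exp_minus field_simps)
        finally show ?thesis .
      qed
      have "(LBINT t=0..ereal x. eval_fps H t * exp (- exp t)) =
          (LBINT t=0..ereal x. (LBINT r=0..ereal t. r ^ (k - 2) / fact (k - 2) * exp (r - exp t)))"
      proof (rule interval_integral_cong)
        fix t assume "t \<in> einterval (min 0 (ereal x)) (max 0 (ereal x))"
        then have "\<bar>t\<bar> < 1"
          using x by (auto simp: einterval_def min_def max_def zero_ereal_def split: if_splits)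
        then show "eval_fps H t * exp (- exp t) =
            (LBINT r=0..ereal t. r ^ (k - 2) / fact (k - 2) * exp (r - exp t))"
          by (rule inner)
      qed
      then show ?thesis
        using sol True E0 by simp
    qed
  qed
  \<comment> \<open>An expansion at 0 asks for a positive radius and for agreement near 0, so the
    unit ball suffices.\<close>
  have "eventually (\<lambda>x. eval_fps ?E x = ?f x) (nhds 0)"
  proof (rule eventually_mono)
    show "eventually (\<lambda>x::real. x \<in> ball 0 1) (nhds 0)"
      by (intro eventually_nhds_in_open) auto
    show "eval_fps ?E x = ?f x" if "x \<in> ball 0 1" for x
      using that by (intro eval_E) simp
  qed
  moreover have "fps_conv_radius ?E > 0"
    using rE by (rule less_le_trans[rotated]) simp
  ultimately show ?thesis
    unfolding has_fps_expansion_def by blast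
qed

end
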